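(* For every positive integer $k$ and every integer $n\ge 2^k$, \[ n-\log_2(k)\le \operatorname{ec}(n,k)\le n-2^k+\operatorname{ec}(2^k,k).\]
   Context: A hyperplane in $\mathbb{R}^n$ is a set $\{x\in\mathbb{R}^n : v_1x_1+\dots+v_nx_n=\alpha\}$ with $v\in\mathbb{R}^n\setminus\{0\}$ and $\alpha\in\mathbb{R}$. For $B\subseteq\{0,1\}^n$, an exact cover of $B$ is a finite set of hyperplanes whose union intersects $\{0,1\}^n$ exactly in $B$. The exact cover number $\operatorname{ec}(B)$ is the minimum size of an exact cover of $B$. For $n\in\mathbb{N}$ and $k\in\{1,\dots,2^n\}$, define $\operatorname{ec}(n,k)=\max\{\operatorname{ec}(\{0,1\}^n\setminus S): S\subseteq\{0,1\}^n,\ |S|=k\}$. *)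

theory Defs
  imports Complex_Main "Jordan_Normal_Form.Matrix"
begin

definition is_hyperplane :: "nat \<Rightarrow> real vec set \<Rightarrow> bool" where
  "is_hyperplane n H \<longleftrightarrow>
     (\<exists>v \<in> carrier_vec n. \<exists>\<alpha>. v \<noteq> 0\<^sub>v n \<and> H = {x \<in> carrier_vec n. v \<bullet> x = \<alpha>})"

definition hypercube :: "nat \<Rightarrow> real vec set" where
  "hypercube n = {x \<in> carrier_vec n. \<forall>i<n. x $ i \<in> {0, 1}}"

definition is_exact_cover :: "nat \<Rightarrow> real vec set \<Rightarrow> real vec set set \<Rightarrow> bool" where
  "is_exact_cover n B C \<longleftrightarrow>
     finite C \<and> (\<forall>H \<in> C. is_hyperplane n H) \<and> \<Union>C \<inter> hypercube n = B"

text \<open>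
  The dimension is an explicit argument because it cannot be recovered from an empty set.
  For a subset \<open>B\<close> of the cube, exact covers exist (each vertex is cut out by a single
  hyperplane) unless \<open>n = 0\<close> and \<open>B\<close> is the whole cube; \<open>B\<close> is never the whole cube in the
  definition of \<open>ec\<close> below when \<open>k \<ge> 1\<close>. The empty set is covered by \<open>C = {}\<close>.
\<close>

definition exact_cover_number :: "nat \<Rightarrow> real vec set \<Rightarrow> nat" where
  "exact_cover_number n B = (LEAST m. \<exists>C. is_exact_cover n B C \<and> card C = m)"

text \<open>The maximum is over a nonempty finite set exactly when \<open>k \<le> 2 ^ n\<close>.\<close>

definition ec :: "nat \<Rightarrow> nat \<Rightarrow> nat" where
  "ec n k = Max {exact_cover_number n (hypercube n - S) | S. S \<subseteq> hypercube n \<and> card S = k}"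

end

theory Submission
  imports Defs
begin

text \<open>
  Upper bound: the \<open>k\<close> points of \<open>S\<close> give at most \<open>2 ^ k\<close> distinct coordinate columns, so in
  dimension above \<open>2 ^ k\<close> two coordinates \<open>i \<noteq> j\<close> agree on \<open>S\<close>. Deleting coordinate \<open>j\<close> and
  adding the single hyperplane \<open>x\<^sub>i + x\<^sub>j = 1\<close> to a cover in the smaller cube costs one hyperplane
  per dimension. Lower bound: the product of the \<open>m\<close> affine functions of an exact cover is a
  polynomial of degree at most \<open>m\<close> whose non-zeros on the cube are exactly \<open>S\<close>, and a non-zero
  multilinear polynomial of degree at most \<open>m\<close> has at least \<open>2 ^ (n - m)\<close> non-zeros on the cube.
\<close>

section \<open>Non-zeros of low-degree functions on the cube\<close>

text \<open>
  Functions on the cube are taken on subsets of \<open>{..<n}\<close>. Membership means having multilinear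
  degree strictly below the second argument, expressed by discrete derivatives in the last variable.
\<close>

fun degree_less :: "nat \<Rightarrow> nat \<Rightarrow> (nat set \<Rightarrow> real) \<Rightarrow> bool" where
  "degree_less n 0 f \<longleftrightarrow> (\<forall>A\<subseteq>{..<n}. f A = 0)"
| "degree_less 0 (Suc m) f \<longleftrightarrow> True"
| "degree_less (Suc n) (Suc m) f \<longleftrightarrow>
     degree_less n (Suc m) f \<and> degree_less n m (\<lambda>A. f (insert n A) - f A)"

lemma subset_lessThan_Suc_insert: "A \<subseteq> {..<n} \<Longrightarrow> insert n A \<subseteq> {..<Suc n}"
  by auto

lemma degree_less_cong:
  "(\<And>A. A \<subseteq> {..<n} \<Longrightarrow> f A = g A) \<Longrightarrow> degree_less n m f \<Longrightarrow> degree_less n m g"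
proof (induction n m f arbitrary: g rule: degree_less.induct)
  case (3 n m f)
  have "f A = g A" "f (insert n A) = g (insert n A)" if "A \<subseteq> {..<n}" for A
    using that by (auto intro!: "3.prems"(1) simp: subset_iff less_Suc_eq)
  then show ?case
    using 3 by (auto intro: "3.IH"(1)[of g] "3.IH"(2)[of "\<lambda>A. g (insert n A) - g A"])
qed auto

lemma degree_less_scale: "degree_less n m f \<Longrightarrow> degree_less n m (\<lambda>A. c * f A)"
proof (induction n m f rule: degree_less.induct)
  case (3 n m f)
  then show ?case by (simp add: right_diff_distrib)
qed auto

lemma degree_less_add:
  "degree_less n m f \<Longrightarrow> degree_less n m g \<Longrightarrow> degree_less n m (\<lambda>A. f A + g A)"
proof (induction n m f arbitrary: g rule: degree_less.induct)
  case (3 n m f)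
  then show ?case
    using "3.IH"(1)[of g] "3.IH"(2)[of "\<lambda>A. g (insert n A) - g A"]
    by (simp add: add_diff_add)
qed auto

text \<open>Discrete Leibniz rule: the difference of the product in direction \<open>n\<close> is an
  affine factor times the difference of \<open>f\<close>, plus \<open>v n * f\<close>. The affine
  constant moves from \<open>c\<close> to \<open>c + v n\<close>, so the induction keeps
  \<open>c\<close> arbitrary.\<close>

lemma degree_less_mult_affine:
  "degree_less n m f \<Longrightarrow> degree_less n (Suc m) (\<lambda>A. (c + sum v A) * f A)"
proof (induction n m f arbitrary: c rule: degree_less.induct)
  case (1 n f)
  then show ?case
  \<comment> \<open>\<open>f\<close> vanishes here, but the bound \<open>Suc 0\<close> on the
    product still unfolds along \<open>n\<close>, hence an inner induction.\<close>
  proof (induction n arbitrary: f c)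
    case (Suc n)
    then have "degree_less n (Suc 0) (\<lambda>A. (c + sum v A) * f A)"
      by (simp add: subset_iff less_Suc_eq)
    moreover have "f A = 0" "f (insert n A) = 0" if "A \<subseteq> {..<n}" for A
      using that Suc.prems subset_lessThan_Suc_insert[OF that] by (auto simp: subset_iff less_Suc_eq)
    ultimately show ?case by simp
  qed simp
next
  case (3 n m f)
  let ?d = "\<lambda>A. f (insert n A) - f A"
  have "degree_less n (Suc m) (\<lambda>A. ((c + v n) + sum v A) * ?d A + v n * f A)"
    using 3 by (intro degree_less_add degree_less_scale) auto
  then have "degree_less n (Suc m) (\<lambda>A. (c + sum v (insert n A)) * f (insert n A) - (c + sum v A) * f A)"
  proof (rule degree_less_cong[rotated])
    fix A assume "A \<subseteq> {..<n}"
    then have "finite A" "n \<notin> A"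
      by (auto intro: finite_subset)
    then show "((c + v n) + sum v A) * ?d A + v n * f A =
        (c + sum v (insert n A)) * f (insert n A) - (c + sum v A) * f A"
      by (simp add: algebra_simps)
  qed
  then show ?case using 3 by simp
qed simp

lemma degree_less_const: "degree_less n (Suc 0) (\<lambda>A. c)"
  by (induction n) auto

lemma degree_less_prod_affine:
  "finite C \<Longrightarrow> degree_less n (Suc (card C)) (\<lambda>A. \<Prod>H\<in>C. c H + sum (v H) A)"
proof (induction C rule: finite_induct)
  case empty
  show ?case by (simp add: degree_less_const)
next
  case (insert H C)
  then show ?case
    using degree_less_mult_affine[OF insert.IH, of "c H" "v H"] by (simp del: degree_less.simps)
qed

text \<open>Splits the cube into the two faces of its last coordinate, for the induction
  below.\<close>

lemma card_nonzeros_Suc: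
  "card {A \<in> Pow {..<Suc n}. P A} =
   card {A \<in> Pow {..<n}. P A} + card {A \<in> Pow {..<n}. P (insert n A)}"
proof -
  have eq: "{A \<in> Pow {..<Suc n}. P A} =
    {A \<in> Pow {..<n}. P A} \<union> insert n ` {A \<in> Pow {..<n}. P (insert n A)}"
    by (auto simp: lessThan_Suc Pow_insert)
  have "inj_on (insert n) (Pow {..<n})"
    by (rule inj_onI) (metis PowD insert_ident lessThan_iff less_irrefl subsetD)
  then have "card (insert n ` {A \<in> Pow {..<n}. P (insert n A)}) =
      card {A \<in> Pow {..<n}. P (insert n A)}"
    by (intro card_image) (auto elim: inj_on_subset)
  then show ?thesis
    unfolding eq by (subst card_Un_disjoint) auto
qed

text \<open>Real analogue of the minimum distance of Reed-Muller codes, by splitting along the last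
  coordinate. The factor \<open>2 ^ m\<close> stands on the right to avoid the truncated exponent
  \<open>n - m\<close>.\<close>

lemma card_nonzeros_ge:
  assumes "degree_less n (Suc m) f" "\<exists>A\<subseteq>{..<n}. f A \<noteq> 0"
  shows "2 ^ n \<le> card {A \<in> Pow {..<n}. f A \<noteq> 0} * 2 ^ m"
  using assms
proof (induction n arbitrary: m f)
  case 0
  then have "{A \<in> Pow {..<0}. f A \<noteq> 0} = {{}}"
    by auto
  then show ?case by simp
next
  case (Suc n)
  let ?f1 = "\<lambda>A. f (insert n A)"
  let ?d = "\<lambda>A. ?f1 A - f A"
  let ?N = "\<lambda>g::nat set \<Rightarrow> real. card {A \<in> Pow {..<n}. g A \<noteq> 0}"
  have f: "degree_less n (Suc m) f" and d: "degree_less n m ?d"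
    using Suc.prems by auto
  have card: "card {A \<in> Pow {..<Suc n}. f A \<noteq> 0} = ?N f + ?N ?f1"
    by (rule card_nonzeros_Suc)
  \<comment> \<open>Multiplying by the constant affine function 1 relaxes the degree bound by
    one.\<close>
  have dS: "degree_less n (Suc m) ?d"
    using degree_less_mult_affine[OF d, of 1 "\<lambda>_. 0"] by simp
  have f1: "degree_less n (Suc m) ?f1"
    using degree_less_add[OF f dS] by simp
  have nz: "(\<exists>A\<subseteq>{..<n}. f A \<noteq> 0) \<or> (\<exists>A\<subseteq>{..<n}. ?f1 A \<noteq> 0)"
  proof -
    have "card {A \<in> Pow {..<Suc n}. f A \<noteq> 0} \<noteq> 0"
      using Suc.prems(2) by auto
    then have "?N f \<noteq> 0 \<or> ?N ?f1 \<noteq> 0"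
      unfolding card by simp
    then show ?thesis by (auto simp: card_eq_0_iff)
  qed
  \<comment> \<open>If \<open>f\<close> vanishes on one face, its restriction to the other is \<open>\<plusminus>?d\<close>, of lower degree.\<close>
  have half: "2 ^ Suc n \<le> ?N g * 2 ^ m"
    if nzg: "\<exists>A\<subseteq>{..<n}. g A \<noteq> 0" and gd: "\<And>A. A \<subseteq> {..<n} \<Longrightarrow> c * ?d A = g A" for g and c :: real
  proof -
    have g: "degree_less n m g"
      using degree_less_cong[of n "\<lambda>A. c * ?d A" g, OF gd degree_less_scale[OF d]] by simp
    \<comment> \<open>A bound \<open>m = 0\<close> would force \<open>g\<close> to vanish.\<close>
    with nzg obtain m' where m: "m = Suc m'"
      by (cases m) auto
    show ?thesis
      using Suc.IH[OF g[unfolded m] nzg] by (simp add: m)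
  qed
  show ?case
  proof (cases "\<exists>A\<subseteq>{..<n}. f A \<noteq> 0")
    case False
    then have "2 ^ Suc n \<le> ?N ?f1 * 2 ^ m"
      using nz half[of ?f1 1] by auto
    then show ?thesis by (simp only: card add_mult_distrib)
  next
    case f0: True
    show ?thesis
    proof (cases "\<exists>A\<subseteq>{..<n}. ?f1 A \<noteq> 0")
      case False
      then have "2 ^ Suc n \<le> ?N f * 2 ^ m"
        using nz half[of f "-1"] by auto
      then show ?thesis by (simp only: card add_mult_distrib)
    next
      case True
      \<comment> \<open>Both faces are non-zero with the same degree bound, so the two inductive
        counts add up.\<close>
      show ?thesis
        using Suc.IH[OF f f0] Suc.IH[OF f1 True] by (simp only: card add_mult_distrib) simp
    qed
  qed
qed

section \<open>Vertices and exact covers\<close>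

text \<open>Identifies subsets of \<open>{..<n}\<close> with cube points, so that scalar products
  become sums over sets.\<close>

definition vertex :: "nat \<Rightarrow> nat set \<Rightarrow> real vec" where
  "vertex n A = vec n (\<lambda>i. of_bool (i \<in> A))"

lemma bij_betw_vertex: "bij_betw (vertex n) (Pow {..<n}) (hypercube n)"
proof (rule bij_betw_imageI)
  show "inj_on (vertex n) (Pow {..<n})"
  proof (rule inj_onI)
    fix A B assume AB: "A \<in> Pow {..<n}" "B \<in> Pow {..<n}" "vertex n A = vertex n B"
    have "i \<in> A \<longleftrightarrow> i \<in> B" if "i < n" for i
      using arg_cong[OF AB(3), of "\<lambda>x. x $ i"] that
      by (simp add: vertex_def of_bool_eq_iff)
    then show "A = B" using AB(1,2) by auto
  qed
  show "vertex n ` Pow {..<n} = hypercube n"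
  proof (intro equalityI subsetI)
    fix x assume "x \<in> hypercube n"
    then have "x = vertex n {i. i < n \<and> x $ i = 1}"
      by (intro eq_vecI) (auto simp: vertex_def hypercube_def)
    then show "x \<in> vertex n ` Pow {..<n}" by blast
  qed (auto simp: vertex_def hypercube_def)
qed

lemma finite_hypercube: "finite (hypercube n)"
  using bij_betw_finite[OF bij_betw_vertex] by simp

lemma card_hypercube: "card (hypercube n) = 2 ^ n"
  using bij_betw_same_card[OF bij_betw_vertex] by (simp add: card_Pow)

lemma scalar_prod_vertex:
  assumes "A \<subseteq> {..<n}"
  shows "v \<bullet> vertex n A = (\<Sum>i\<in>A. v $ i)"
proof -
  have "v \<bullet> vertex n A = (\<Sum>i<n. if i \<in> A then v $ i else 0)"
    unfolding scalar_prod_def by (rule sum.cong) (auto simp: vertex_def)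
  also have "\<dots> = (\<Sum>i\<in>A. v $ i)"
    using assms by (simp add: sum.inter_restrict[symmetric] Int_absorb1)
  finally show ?thesis .
qed

text \<open>Multiplicative form of the lower bound; \<open>S \<noteq> {}\<close> ensures that the
  product polynomial is not identically zero on the cube.\<close>

lemma exact_cover_card_ge:
  assumes S: "S \<subseteq> hypercube n" "S \<noteq> {}" and C: "is_exact_cover n (hypercube n - S) C"
  shows "2 ^ n \<le> card S * 2 ^ card C"
proof -
  have fin: "finite C" and U: "\<Union>C \<inter> hypercube n = hypercube n - S"
    and hyp: "\<forall>H\<in>C. is_hyperplane n H"
    using C by (auto simp: is_exact_cover_def)
  have "\<exists>v \<alpha>. H = {x \<in> carrier_vec n. v \<bullet> x = \<alpha>}" if "is_hyperplane n H" for H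
    using that unfolding is_hyperplane_def by fast
  with hyp have "\<forall>H\<in>C. \<exists>v \<alpha>. H = {x \<in> carrier_vec n. v \<bullet> x = \<alpha>}"
    by simp
  then obtain v \<alpha> where
    H: "\<And>H. H \<in> C \<Longrightarrow> H = {x \<in> carrier_vec n. v H \<bullet> x = \<alpha> H}"
    unfolding bchoice_iff by (elim exE) blast
  \<comment> \<open>At a vertex \<open>x\<close> each factor is
    \<open>v H \<bullet> x - \<alpha> H\<close>, which is zero exactly when \<open>x\<close> lies on
    \<open>H\<close>.\<close>
  let ?f = "\<lambda>A. \<Prod>H\<in>C. - \<alpha> H + (\<Sum>i\<in>A. v H $ i)"
  have f: "?f A \<noteq> 0 \<longleftrightarrow> vertex n A \<in> S" if A: "A \<subseteq> {..<n}" for A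
  proof -
    have x: "vertex n A \<in> hypercube n"
      using bij_betwE[OF bij_betw_vertex] A by blast
    have "vertex n A \<in> H \<longleftrightarrow> - \<alpha> H + (\<Sum>i\<in>A. v H $ i) = 0" if "H \<in> C" for H
    proof -
      have "vertex n A \<in> H \<longleftrightarrow> v H \<bullet> vertex n A = \<alpha> H"
        using x by (subst H[OF that]) (simp add: hypercube_def)
      then show ?thesis using scalar_prod_vertex[OF A] by auto
    qed
    then have "?f A \<noteq> 0 \<longleftrightarrow> vertex n A \<notin> \<Union>C"
      using fin by auto
    then show ?thesis using x U by blast
  qed
  have img: "vertex n ` {A \<in> Pow {..<n}. ?f A \<noteq> 0} = S"
  proof -
    have "{A \<in> Pow {..<n}. ?f A \<noteq> 0} = {A \<in> Pow {..<n}. vertex n A \<in> S}"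
      using f by blast
    moreover have "x \<in> vertex n ` {A \<in> Pow {..<n}. vertex n A \<in> S}" if "x \<in> S" for x
    proof -
      have "x \<in> vertex n ` Pow {..<n}"
        using S(1) that bij_betw_imp_surj_on[OF bij_betw_vertex[of n]] by auto
      then show ?thesis using that by blast
    qed
    then have "vertex n ` {A \<in> Pow {..<n}. vertex n A \<in> S} = S"
      by blast
    ultimately show ?thesis by simp
  qed
  have "card {A \<in> Pow {..<n}. ?f A \<noteq> 0} = card S"
    unfolding img[symmetric]
    by (rule card_image[symmetric], rule inj_on_subset[OF bij_betw_imp_inj_on[OF bij_betw_vertex]]) auto
  moreover have "\<exists>A\<subseteq>{..<n}. ?f A \<noteq> 0"
    using img S(2) by blast
  ultimately show ?thesis
    using card_nonzeros_ge[OF degree_less_prod_affine[OF fin], of n "\<lambda>H. - \<alpha> H" "\<lambda>H i. v H $ i"]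
    by auto
qed

text \<open>On the cube, \<open>(2p - 1) \<bullet> x\<close> attains its maximum exactly at the vertex \<open>p\<close>.\<close>

lemma vertex_hyperplane:
  assumes n: "n \<ge> 1" and p: "p \<in> hypercube n"
  obtains H where "is_hyperplane n H" "H \<inter> hypercube n = {p}"
proof -
  define v :: "real vec" where "v = vec n (\<lambda>i. 2 * p $ i - 1)"
  define H where "H = {x \<in> carrier_vec n. v \<bullet> x = v \<bullet> p}"
  \<comment> \<open>All entries of \<open>v\<close> are 1 or -1, and \<open>n \<ge> 1\<close>
    supplies one of them.\<close>
  have "v $ 0 \<noteq> 0"
    using n p by (auto simp: v_def hypercube_def)
  then have "v \<noteq> 0\<^sub>v n"
    using n by auto
  then have "is_hyperplane n H"
    unfolding is_hyperplane_def H_def by (intro bexI[of _ v] exI[of _ "v \<bullet> p"]) (auto simp: v_def)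
  moreover have "x = p" if x: "x \<in> hypercube n" and eq: "v \<bullet> x = v \<bullet> p" for x
  proof -
    have xp: "x $ i \<in> {0, 1}" "p $ i \<in> {0, 1}" if "i < n" for i
      using x p that by (auto simp: hypercube_def)
    have vy: "v \<bullet> y = (\<Sum>i<n. (2 * p $ i - 1) * y $ i)" if "y \<in> hypercube n" for y
      using that unfolding scalar_prod_def by (intro sum.cong) (auto simp: v_def hypercube_def)
    \<comment> \<open>Each summand is 1 where \<open>x\<close> and \<open>p\<close> differ and 0
      elsewhere, so a zero sum forces \<open>x = p\<close>.\<close>
    have "(\<Sum>i<n. (2 * p $ i - 1) * (p $ i - x $ i)) = v \<bullet> p - v \<bullet> x"
      using vy[OF x] vy[OF p] by (simp add: right_diff_distrib sum_subtractf)
    then have "(\<Sum>i<n. (2 * p $ i - 1) * (p $ i - x $ i)) = 0"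
      using eq by simp
    moreover have "(2 * p $ i - 1) * (p $ i - x $ i) \<ge> 0" if "i < n" for i
      using xp[OF that] by auto
    ultimately have "(2 * p $ i - 1) * (p $ i - x $ i) = 0" if "i < n" for i
      using that by (subst (asm) sum_nonneg_eq_0_iff) auto
    then have "x $ i = p $ i" if "i < n" for i
      using xp[OF that] that by fastforce
    then show ?thesis
      using x p by (intro eq_vecI) (auto simp: hypercube_def)
  qed
  ultimately show ?thesis
    using p by (intro that[of H]) (auto simp: H_def hypercube_def)
qed

text \<open>One hyperplane per point of \<open>B\<close>. This makes the \<open>LEAST\<close> in
  \<open>exact_cover_number\<close> range over a nonempty set.\<close>

lemma exact_cover_exists:
  assumes n: "n \<ge> 1" and B: "B \<subseteq> hypercube n"
  shows "\<exists>C. is_exact_cover n B C"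
proof -
  have "\<forall>p\<in>B. \<exists>H. is_hyperplane n H \<and> H \<inter> hypercube n = {p}"
    using vertex_hyperplane[OF n] B by (metis subsetD)
  then obtain H where H: "\<And>p. p \<in> B \<Longrightarrow> is_hyperplane n (H p) \<and> H p \<inter> hypercube n = {p}"
    by metis
  have "\<Union>(H ` B) \<inter> hypercube n = (\<Union>p\<in>B. H p \<inter> hypercube n)"
    by blast
  also have "\<dots> = B"
    using H by simp
  finally have "is_exact_cover n B (H ` B)"
    using H finite_subset[OF B finite_hypercube] by (auto simp: is_exact_cover_def)
  then show ?thesis ..
qed

section \<open>Minimum exact covers and the value of \<open>ec\<close>\<close>

lemma exact_cover_number_le: "is_exact_cover n B C \<Longrightarrow> exact_cover_number n B \<le> card C"
  unfolding exact_cover_number_def by (rule Least_le) blast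

lemma minimum_exact_cover:
  assumes "n \<ge> 1" "B \<subseteq> hypercube n"
  obtains C where "is_exact_cover n B C" "card C = exact_cover_number n B"
proof -
  have "\<exists>m C. is_exact_cover n B C \<and> card C = m"
    using exact_cover_exists[OF assms] by blast
  then have "\<exists>C. is_exact_cover n B C \<and> card C = exact_cover_number n B"
    unfolding exact_cover_number_def by (rule LeastI_ex)
  then show ?thesis using that by blast
qed

lemma finite_ec_set:
  "finite {exact_cover_number n (hypercube n - S) | S. S \<subseteq> hypercube n \<and> card S = k}"
  by (rule finite_subset[of _ "(\<lambda>S. exact_cover_number n (hypercube n - S)) ` Pow (hypercube n)"])
    (auto simp: finite_hypercube)

lemma exact_cover_number_le_ec:
  "S \<subseteq> hypercube n \<Longrightarrow> exact_cover_number n (hypercube n - S) \<le> ec n (card S)"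
  unfolding ec_def by (rule Max_ge[OF finite_ec_set]) blast

lemma ec_attained:
  assumes "k \<le> 2 ^ n"
  obtains S where "S \<subseteq> hypercube n" "card S = k"
    "ec n k = exact_cover_number n (hypercube n - S)"
proof -
  obtain T where "T \<subseteq> hypercube n" "card T = k"
    using obtain_subset_with_card_n[of k "hypercube n"] assms by (auto simp: card_hypercube)
  then have "{exact_cover_number n (hypercube n - S) | S. S \<subseteq> hypercube n \<and> card S = k} \<noteq> {}"
    by blast
  from Max_in[OF finite_ec_set this] show ?thesis
    using that unfolding ec_def by auto
qed

section \<open>Removing a duplicated coordinate\<close>

text \<open>Cube points with \<open>x $ i = x $ j\<close> form a copy of the \<open>n\<close>-cube
  via deletion of coordinate \<open>j\<close>; the remaining points all lie outside \<open>S\<close>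
  and are covered by one extra hyperplane.\<close>

lemma exact_cover_duplicate_coordinate:
  assumes S: "S \<subseteq> hypercube (Suc n)" and n: "n \<ge> 1"
    and ij: "i < Suc n" "j < Suc n" "i \<noteq> j" and dup: "\<And>x. x \<in> S \<Longrightarrow> x $ i = x $ j"
  shows "exact_cover_number (Suc n) (hypercube (Suc n) - S) \<le> ec n (card S) + 1"
proof -
  have "card {..<n} = card ({..<Suc n} - {j})"
    using ij by simp
  \<comment> \<open>\<open>\<sigma>\<close> enumerates the coordinates other than
    \<open>j\<close>.\<close>
  then obtain \<sigma> where \<sigma>: "bij_betw \<sigma> {..<n} ({..<Suc n} - {j})"
    using finite_same_card_bij[of "{..<n}" "{..<Suc n} - {j}"] by auto
  define drop_j :: "real vec \<Rightarrow> real vec" where "drop_j x = vec n (\<lambda>l. x $ \<sigma> l)" for x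
  have \<sigma>_less: "\<sigma> l < Suc n" "\<sigma> l \<noteq> j" if "l < n" for l
    using bij_betwE[OF \<sigma>] that by auto
  have drop_cube: "drop_j x \<in> hypercube n" if "x \<in> hypercube (Suc n)" for x
    using that \<sigma>_less by (auto simp: drop_j_def hypercube_def)
  have drop_inj: "x = y"
    if xy: "x \<in> hypercube (Suc n)" "y \<in> hypercube (Suc n)" "x $ i = x $ j" "y $ i = y $ j"
      "drop_j x = drop_j y" for x y
  proof (rule eq_vecI)
    have off: "x $ l = y $ l" if l: "l < Suc n" "l \<noteq> j" for l
    proof -
      obtain l' where l': "l' < n" "l = \<sigma> l'"
        using bij_betw_imp_surj_on[OF \<sigma>] l by (metis DiffI imageE lessThan_iff singletonD)
      then show ?thesis
        using arg_cong[OF xy(5), of "\<lambda>z. z $ l'"] by (simp add: drop_j_def)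
    qed
    \<comment> \<open>The deleted coordinate \<open>j\<close> is recovered from coordinate
      \<open>i\<close>.\<close>
    show "x $ l = y $ l" if "l < dim_vec y" for l
      using off[of l] off[of i] xy ij that by (cases "l = j") (auto simp: hypercube_def)
  qed (use xy in \<open>auto simp: hypercube_def\<close>)
  have "inj_on drop_j S"
    using S dup drop_inj by (meson inj_onI subsetD)
  then have card: "card (drop_j ` S) = card S"
    by (rule card_image)
  have dS: "drop_j ` S \<subseteq> hypercube n"
    using S drop_cube by blast
  obtain C where C: "is_exact_cover n (hypercube n - drop_j ` S) C"
    and card_C: "card C = exact_cover_number n (hypercube n - drop_j ` S)"
    using minimum_exact_cover[OF n Diff_subset] by blast
  define lift where "lift H = {x \<in> carrier_vec (Suc n). drop_j x \<in> H}" for H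
  have lift: "is_hyperplane (Suc n) (lift H)" if "is_hyperplane n H" for H
  proof -
    from that obtain v \<alpha> where v: "v \<in> carrier_vec n" "v \<noteq> 0\<^sub>v n"
      "H = {x \<in> carrier_vec n. v \<bullet> x = \<alpha>}"
      by (auto simp: is_hyperplane_def)
    \<comment> \<open>\<open>w\<close> carries the entries of \<open>v\<close> back along
      \<open>\<sigma>\<close>, with 0 at \<open>j\<close>, so the lifted hyperplane ignores
      coordinate \<open>j\<close>.\<close>
    define w where
      "w = vec (Suc n) (\<lambda>l. if l = j then 0 else v $ inv_into {..<n} \<sigma> l)"
    have w\<sigma>: "w $ \<sigma> l = v $ l" if "l < n" for l
      using that \<sigma>_less[OF that] bij_betw_inv_into_left[OF \<sigma>] by (simp add: w_def)
    have "w \<bullet> x = v \<bullet> drop_j x" if x: "x \<in> carrier_vec (Suc n)" for x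
    proof -
      have "w \<bullet> x = (\<Sum>l<Suc n. w $ l * x $ l)"
        using x by (simp add: scalar_prod_def lessThan_atLeast0)
      also have "\<dots> = (\<Sum>l\<in>{..<Suc n} - {j}. w $ l * x $ l)"
        using ij by (intro sum.mono_neutral_right) (auto simp: w_def)
      also have "\<dots> = (\<Sum>l<n. w $ \<sigma> l * x $ \<sigma> l)"
        by (rule sum.reindex_bij_betw[OF \<sigma>, symmetric])
      also have "\<dots> = v \<bullet> drop_j x"
        by (simp add: scalar_prod_def drop_j_def lessThan_atLeast0 w\<sigma>)
      finally show ?thesis .
    qed
    then have "lift H = {x \<in> carrier_vec (Suc n). w \<bullet> x = \<alpha>}"
      by (auto simp: lift_def v drop_j_def)
    moreover have "w \<noteq> 0\<^sub>v (Suc n)"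
    proof
      assume w0: "w = 0\<^sub>v (Suc n)"
      have "v $ l = 0" if "l < n" for l
        using w\<sigma>[OF that] \<sigma>_less[OF that] by (simp add: w0)
      then have "v = 0\<^sub>v n"
        using v(1) by (intro eq_vecI) auto
      with v(2) show False ..
    qed
    moreover have "w \<in> carrier_vec (Suc n)"
      by (simp add: w_def)
    ultimately show ?thesis
      unfolding is_hyperplane_def by blast
  qed
  define u :: "real vec" where "u = unit_vec (Suc n) i + unit_vec (Suc n) j"
  define H0 where "H0 = {x \<in> carrier_vec (Suc n). u \<bullet> x = 1}"
  have "u $ i \<noteq> 0"
    using ij by (simp add: u_def)
  then have "u \<noteq> 0\<^sub>v (Suc n)"
    using ij by auto
  then have hyp0: "is_hyperplane (Suc n) H0"
    unfolding is_hyperplane_def H0_def by (intro bexI[of _ u]) (auto simp: u_def)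
  have "u \<bullet> x = x $ i + x $ j" if "x \<in> carrier_vec (Suc n)" for x
    using that ij unfolding u_def by (subst add_scalar_prod_distrib[of _ "Suc n"]) auto
  then have "x \<in> H0 \<longleftrightarrow> x $ i + x $ j = 1" if "x \<in> hypercube (Suc n)" for x
    using that by (simp add: H0_def hypercube_def)
  moreover have "x $ i \<in> {0, 1}" "x $ j \<in> {0, 1}" if "x \<in> hypercube (Suc n)" for x
    using that ij by (auto simp: hypercube_def)
  ultimately have H0: "x \<in> H0 \<longleftrightarrow> x $ i \<noteq> x $ j" if "x \<in> hypercube (Suc n)" for x
    using that by fastforce
  have CU: "x \<in> \<Union>C \<longleftrightarrow> x \<notin> drop_j ` S" if "x \<in> hypercube n" for x
    using C that by (auto simp: is_exact_cover_def)
  \<comment> \<open>Points with differing coordinates \<open>i\<close> and \<open>j\<close> lie in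
    \<open>H0\<close> and outside \<open>S\<close>; on the others, injectivity of
    \<open>drop_j\<close> makes the lifted cover exact.\<close>
  have "x \<in> \<Union>(insert H0 (lift ` C)) \<longleftrightarrow> x \<notin> S" if x: "x \<in> hypercube (Suc n)" for x
  proof -
    have "x \<in> \<Union>(lift ` C) \<longleftrightarrow> drop_j x \<notin> drop_j ` S"
      using x by (subst CU[OF drop_cube[OF x], symmetric]) (auto simp: lift_def hypercube_def)
    moreover have "x \<in> S" if eq: "x $ i = x $ j" and mem: "drop_j x \<in> drop_j ` S"
    proof -
      obtain y where "y \<in> S" "drop_j x = drop_j y"
        using mem by blast
      then show ?thesis
        using drop_inj[OF x _ eq] S dup by (metis subsetD)
    qed
    ultimately show ?thesis
      using H0[OF x] dup by auto
  qed
  then have "is_exact_cover (Suc n) (hypercube (Suc n) - S) (insert H0 (lift ` C))"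
    using C lift hyp0 unfolding is_exact_cover_def by blast
  then have "exact_cover_number (Suc n) (hypercube (Suc n) - S) \<le> card (insert H0 (lift ` C))"
    by (rule exact_cover_number_le)
  also have "\<dots> \<le> card C + 1"
    using C card_insert_le_m1[of "card C + 1" "lift ` C" H0] card_image_le[of C lift]
    by (simp add: is_exact_cover_def)
  also have "card C \<le> ec n (card S)"
    using exact_cover_number_le_ec[OF dS] by (simp add: card card_C)
  finally show ?thesis by simp
qed

text \<open>Pigeonhole: the \<open>Suc n\<close> coordinate columns are subsets of a
  \<open>k\<close>-element set, and there are only \<open>2 ^ k < Suc n\<close> of those.\<close>

lemma ec_Suc_le:
  assumes k: "k \<ge> 1" and n: "n \<ge> 2 ^ k"
  shows "ec (Suc n) k \<le> ec n k + 1"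
proof -
  have "k \<le> 2 ^ Suc n"
    using n less_exp[of k] less_exp[of "Suc n"] by linarith
  then obtain S where S: "S \<subseteq> hypercube (Suc n)" "card S = k"
    and ec: "ec (Suc n) k = exact_cover_number (Suc n) (hypercube (Suc n) - S)"
    by (rule ec_attained)
  have finS: "finite S"
    using S(2) k by (intro card_ge_0_finite) simp
  let ?col = "\<lambda>i. {x \<in> S. x $ i = 1}"
  have "card (?col ` {..<Suc n}) \<le> card (Pow S)"
    using finS by (intro card_mono) auto
  also have "\<dots> < card {..<Suc n}"
    using n finS S(2) by (simp add: card_Pow)
  finally have "\<not> inj_on ?col {..<Suc n}"
    by (rule pigeonhole)
  then obtain i j where ij: "i < Suc n" "j < Suc n" "i \<noteq> j" "?col i = ?col j"
    unfolding inj_on_def by auto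
  have "x $ i = x $ j" if "x \<in> S" for x
  proof -
    have "x $ i \<in> {0, 1}" "x $ j \<in> {0, 1}"
      using that S(1) ij by (auto simp: hypercube_def)
    moreover have "x $ i = 1 \<longleftrightarrow> x $ j = 1"
      using ij(4) that by blast
    ultimately show ?thesis by auto
  qed
  moreover have "n \<ge> 1"
    using n one_le_power[of "2::nat" k] by linarith
  ultimately show ?thesis
    using exact_cover_duplicate_coordinate[OF S(1) _ ij(1-3)] by (simp add: ec S(2))
qed

section \<open>Combining the two bounds\<close>

theorem theorem3:
  fixes n k :: nat
  assumes "k \<ge> 1" and "n \<ge> 2 ^ k"
  shows "real n - log 2 (real k) \<le> real (ec n k) \<and>
         real (ec n k) \<le> real n - 2 ^ k + real (ec (2 ^ k) k)"
proof
  have n: "n \<ge> 1"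
    using assms(2) one_le_power[of "2::nat" k] by linarith
  \<comment> \<open>From \<open>k < 2 ^ k \<le> n < 2 ^ n\<close>; it makes the maximum defining
    \<open>ec n k\<close> range over a nonempty set.\<close>
  have "k \<le> 2 ^ n"
    using assms(2) less_exp[of k] less_exp[of n] by linarith
  then obtain S where S: "S \<subseteq> hypercube n" "card S = k"
    and ec: "ec n k = exact_cover_number n (hypercube n - S)"
    by (rule ec_attained)
  obtain C where C: "is_exact_cover n (hypercube n - S) C" "card C = ec n k"
    unfolding ec using minimum_exact_cover[OF n Diff_subset] by blast
  have "S \<noteq> {}"
    using S(2) assms(1) by auto
  then have "2 ^ n \<le> k * 2 ^ ec n k"
    using exact_cover_card_ge[OF S(1) _ C(1)] by (simp add: S(2) C(2))
  then have "real (2 ^ n) \<le> real (k * 2 ^ ec n k)"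
    by (rule of_nat_mono)
  then have "log 2 (2 ^ n) \<le> log 2 (real k * 2 ^ ec n k)"
    by (intro log_mono) auto
  also have "\<dots> = log 2 (real k) + real (ec n k)"
    using assms(1) by (simp add: log_mult log_nat_power)
  finally show "real n - log 2 (real k) \<le> real (ec n k)"
    by (simp add: log_nat_power)
next
  show "real (ec n k) \<le> real n - 2 ^ k + real (ec (2 ^ k) k)"
    using assms(2)
  \<comment> \<open>Induction upward from \<open>n = 2 ^ k\<close>, where the bound is an equality;
    each further dimension adds at most one.\<close>
  proof (induction n rule: dec_induct)
    case (step n)
    then show ?case
      using ec_Suc_le[OF assms(1) step.hyps(1)] by simp
  qed simp
qed

end
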